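(* Let $(\mathbb{R},\Sigma,\mu)$ be the standard Lebesgue measure space on the real line and let $1\le p\le\infty$. Let $\theta_{A,i},\theta_{B,i},\omega\in\mathbb{R}$, $i=1,2,3,4$, and let $\alpha,\beta,\alpha_1,\beta_1\in\mathbb{R}$ with $\alpha_1<\beta_1$, $\alpha\le\alpha_1$, $\beta\ge\beta_1$. Assume that $\frac{\omega}{\pi}(\beta_1-\alpha_1)\in\mathbb{Z}$ or $\frac{\omega}{\pi}(\beta_1+\alpha_1)\in\mathbb{Z}$. Let $A,B:L_p(\mathbb{R},\mu)\to L_p(\mathbb{R},\mu)$ be defined, for almost every $t$, by $$(Ax)(t)=\int_{\alpha_1}^{\beta_1}I_{[\alpha,\beta]}(t)\big[\theta_{A,1}\sin(\omega t)\cos(\omega s)+\theta_{A,2}\cos(\omega t)\cos(\omega s)+\theta_{A,3}\sin(\omega t)\sin(\omega s)+\theta_{A,4}\cos(\omega t)\sin(\omega s)\big]x(s)\,d\mu_s,$$ $$(Bx)(t)=\int_{\alpha_1}^{\beta_1}I_{[\alpha,\beta]}(t)\big[\theta_{B,1}\sin(\omega t)\cos(\omega s)+\theta_{B,2}\cos(\omega t)\cos(\omega s)+\theta_{B,3}\sin(\omega t)\sin(\omega s)+\theta_{B,4}\cos(\omega t)\sin(\omega s)\big]x(s)\,d\mu_s.$$ Let $$\sigma_1=\int_{\alpha_1}^{\beta_1}(\sin(\omega s))^2\,d\mu_s=\begin{cases}0,&\omega=0,\\ \frac{\beta_1-\alpha_1}{2}-\frac{\cos(\omega(\alpha_1+\beta_1))\sin(\omega(\beta_1-\alpha_1))}{2\omega},&\omega\ne0,\end{cases}$$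 $$\sigma_2=\int_{\alpha_1}^{\beta_1}(\cos(\omega s))^2\,d\mu_s=\beta_1-\alpha_1-\sigma_1=\begin{cases}\beta_1-\alpha_1,&\omega=0,\\ \frac{\beta_1-\alpha_1}{2}+\frac{\cos(\omega(\alpha_1+\beta_1))\sin(\omega(\beta_1-\alpha_1))}{2\omega},&\omega\ne0.\end{cases}$$ Then, for all $x\in L_p(\mathbb{R},\mu)$ and almost every $t$, $$(AB-BA)x(t)=\int_{\alpha_1}^{\beta_1}I_{[\alpha,\beta]}(t)\big((\theta_{A,3}\theta_{B,1}\sigma_1-\theta_{B,3}\theta_{A,1}\sigma_1+\theta_{A,1}\theta_{B,2}\sigma_2-\theta_{B,1}\theta_{A,2}\sigma_2)\sin(\omega t)\cos(\omega s)$$ $$+(\theta_{B,1}\theta_{A,4}-\theta_{A,1}\theta_{B,4})\sigma_1\cos(\omega t)\cos(\omega s)+(\theta_{A,1}\theta_{B,4}-\theta_{B,1}\theta_{A,4})\sigma_2\sin(\omega t)\sin(\omega s)$$ $$+(\theta_{A,4}\theta_{B,3}\sigma_1-\theta_{B,4}\theta_{A,3}\sigma_1+\theta_{A,2}\theta_{B,4}\sigma_2-\theta_{B,2}\theta_{A,4}\sigma_2)\cos(\omega t)\sin(\omega s)\big)x(s)\,d\mu_s.$$ Moreover, if $\sigma_1\ne0$ and $\sigma_2\ne0$, then $AB=BA$ if and only if $$\theta_{A,3}\theta_{B,1}\sigma_1-\theta_{B,3}\theta_{A,1}\sigma_1=\theta_{B,1}\theta_{A,2}\sigma_2-\theta_{A,1}\theta_{B,2}\sigma_2,\qquad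 \theta_{A,4}\theta_{B,1}=\theta_{B,4}\theta_{A,1},$$ $$\theta_{A,4}\theta_{B,3}\sigma_1-\theta_{B,4}\theta_{A,3}\sigma_1=\theta_{B,2}\theta_{A,4}\sigma_2-\theta_{A,2}\theta_{B,4}\sigma_2.$$
   Context: $L_p(\mathbb{R},\mu)$ is the Banach space of (classes modulo null sets of) real-valued measurable functions with $\int|f|^p\,d\mu<\infty$ ($1\le p<\infty$), or essentially bounded ($p=\infty$). $I_E(\cdot)$ denotes the indicator function of the set $E$; the index in $\mu_s$ indicates the variable of integration. *)

theory Defs
  imports "HOL-Analysis.Analysis"
begin

definition Lp_functions :: "'a measure \<Rightarrow> ennreal \<Rightarrow> ('a \<Rightarrow> real) set" where
  "Lp_functions M p =
     {f \<in> borel_measurable M.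
        if p = \<infinity> then (\<exists>C. AE t in M. \<bar>f t\<bar> \<le> C)
        else integrable M (\<lambda>t. \<bar>f t\<bar> powr enn2real p)}"

definition ae_class :: "'a measure \<Rightarrow> ('a \<Rightarrow> real) \<Rightarrow> ('a \<Rightarrow> real) set" where
  "ae_class M f = {g \<in> borel_measurable M. AE t in M. g t = f t}"

text \<open>Only the underlying set of the Banach space is needed. The exponent is a value
  and not a type, so the elements are equivalence classes represented as sets of functions.\<close>

definition Lp_space :: "'a measure \<Rightarrow> ennreal \<Rightarrow> ('a \<Rightarrow> real) set set" where
  "Lp_space M p = ae_class M ` Lp_functions M p"

end

theory Submission
  imports Defs
begin

text \<open>Both operators have a kernel of rank two: with \<open>u = sin (\<omega> \<cdot>)\<close> and \<open>v = cos (\<omega> \<cdot>)\<close>,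
  the value \<open>A x\<close> depends on \<open>x\<close> only through the two moments \<open>\<integral> u x\<close> and \<open>\<integral> v x\<close> over
  \<open>[\<alpha>\<^sub>1, \<beta>\<^sub>1]\<close>, and it is a combination of \<open>u\<close> and \<open>v\<close> cut off to \<open>[\<alpha>, \<beta>]\<close>. So \<open>A\<close> and \<open>B\<close>
  are 2-by-2 matrices \<open>P\<close> and \<open>Q\<close> that send moments to coefficients. To compose them, one needs the
  map from coefficients back to moments, which is the Gram matrix \<open>G\<close> of \<open>u\<close> and \<open>v\<close> on
  \<open>[\<alpha>\<^sub>1, \<beta>\<^sub>1]\<close>; the cut-off is invisible there because \<open>[\<alpha>\<^sub>1, \<beta>\<^sub>1] \<subseteq> [\<alpha>, \<beta>]\<close>. The commutator
  therefore has the matrix \<open>P G Q - Q G P\<close>.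

  The integrality hypothesis says exactly what is needed for \<open>G\<close> to be diagonal, because
  \<open>2 \<omega> \<integral> sin (\<omega> s) cos (\<omega> s) ds = sin (\<omega> (\<beta>\<^sub>1 - \<alpha>\<^sub>1)) sin (\<omega> (\<beta>\<^sub>1 + \<alpha>\<^sub>1))\<close>. The diagonal entries
  are \<open>\<sigma>\<^sub>1\<close> and \<open>\<sigma>\<^sub>2\<close>, and multiplying out gives the four coefficients of the commutator.

  If \<open>\<sigma>\<^sub>1\<close> and \<open>\<sigma>\<^sub>2\<close> are nonzero, then \<open>u\<close> and \<open>v\<close>, cut off to \<open>[\<alpha>, \<beta>]\<close>, serve as test functions
  that isolate each moment, and the moments of the image isolate each coefficient. So an operator
  of this shape vanishes only if its matrix does, and commutation means that all four entries
  of \<open>P G Q - Q G P\<close> are zero. The two diagonal entries give the same equation.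

  The exponent \<open>p\<close> enters only twice: elements of \<open>L\<^sub>p\<close> are integrable on sets of finite measure, which
  makes the moments finite and linear, and bounded functions supported on such sets
  belong to \<open>L\<^sub>p\<close>, which puts the images back into the space.\<close>

section \<open>Representatives of elements of Lp\<close>

lemma ae_class_eq_iff:
  assumes "f \<in> borel_measurable M" "g \<in> borel_measurable M"
  shows "ae_class M f = ae_class M g \<longleftrightarrow> (AE t in M. f t = g t)"
proof
  assume "ae_class M f = ae_class M g"
  then have "f \<in> ae_class M g"
    using assms by (auto simp: ae_class_def)
  then show "AE t in M. f t = g t"
    by (simp add: ae_class_def)
next
  assume fg: "AE t in M. f t = g t"
  have "(AE t in M. h t = f t) \<longleftrightarrow> (AE t in M. h t = g t)" for h
  proof
    assume "AE t in M. h t = f t"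
    then show "AE t in M. h t = g t" using fg by eventually_elim simp
  next
    assume "AE t in M. h t = g t"
    then show "AE t in M. h t = f t" using fg by eventually_elim simp
  qed
  then show "ae_class M f = ae_class M g"
    by (simp add: ae_class_def)
qed

lemma Lp_functions_measurable: "x \<in> Lp_functions M p \<Longrightarrow> x \<in> borel_measurable M"
  by (simp add: Lp_functions_def)

lemma Lp_functions_cong_AE:
  assumes x: "x \<in> Lp_functions M p" and y: "y \<in> borel_measurable M"
    and eq: "AE t in M. y t = x t"
  shows "y \<in> Lp_functions M p"
proof (cases "p = \<infinity>")
  case True
  then obtain C where "AE t in M. \<bar>x t\<bar> \<le> C"
    using x by (auto simp: Lp_functions_def)
  then have "AE t in M. \<bar>y t\<bar> \<le> C"
    using eq by eventually_elim simp
  then show ?thesis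
    using True y by (auto simp: Lp_functions_def)
next
  case False
  have xm: "x \<in> borel_measurable M"
    using x by (rule Lp_functions_measurable)
  have "integrable M (\<lambda>t. \<bar>x t\<bar> powr enn2real p)"
    using x False by (simp add: Lp_functions_def)
  moreover have "AE t in M. \<bar>x t\<bar> powr enn2real p = \<bar>y t\<bar> powr enn2real p"
    using eq by eventually_elim simp
  ultimately have "integrable M (\<lambda>t. \<bar>y t\<bar> powr enn2real p)"
    using xm y by (subst integrable_cong_AE[symmetric]) (auto, measurable)
  then show ?thesis
    using False y by (simp add: Lp_functions_def)
qed

lemma Lp_space_memberD:
  assumes "X \<in> Lp_space M p" "x \<in> X"
  shows "x \<in> Lp_functions M p" and "X = ae_class M x"
proof -
  obtain x0 where x0: "x0 \<in> Lp_functions M p" "X = ae_class M x0"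
    using assms(1) by (auto simp: Lp_space_def)
  have x: "x \<in> borel_measurable M" "AE t in M. x t = x0 t"
    using assms(2) x0(2) by (auto simp: ae_class_def)
  show "x \<in> Lp_functions M p"
    using x0(1) x by (rule Lp_functions_cong_AE)
  show "X = ae_class M x"
    unfolding x0(2) using x Lp_functions_measurable[OF x0(1)]
    by (subst ae_class_eq_iff) (auto elim: eventually_mono)
qed

lemma bounded_finite_support_in_Lp:
  assumes f: "f \<in> borel_measurable M" and E: "E \<in> sets M" "emeasure M E < \<infinity>"
    and bound: "\<And>t. \<bar>f t\<bar> \<le> C" and support: "\<And>t. t \<notin> E \<Longrightarrow> f t = 0"
  shows "f \<in> Lp_functions M p"
proof (cases "p = \<infinity>")
  case True
  then show ?thesis using f bound by (auto simp: Lp_functions_def)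
next
  case False
  let ?q = "enn2real p"
  have "integrable M (\<lambda>t. \<bar>f t\<bar> powr ?q)"
  proof (rule Bochner_Integration.integrable_bound)
    show "integrable M (\<lambda>t. indicator E t * C powr ?q)"
      using E by (intro integrable_mult_left) (simp add: integrable_indicator_iff)
    show "(\<lambda>t. \<bar>f t\<bar> powr ?q) \<in> borel_measurable M"
      using f by measurable
    show "AE t in M. norm (\<bar>f t\<bar> powr ?q) \<le> norm (indicator E t * C powr ?q)"
    proof (rule AE_I2)
      fix t
      show "norm (\<bar>f t\<bar> powr ?q) \<le> norm (indicator E t * C powr ?q)"
        using support[of t] powr_mono2[OF _ _ bound[of t], of ?q]
        by (cases "t \<in> E") auto
    qed
  qed
  then show ?thesis
    using False f by (simp add: Lp_functions_def)
qed

text \<open>On a set of finite measure the constant 1 is integrable, and \<open>\<bar>x\<bar> \<le> 1 + \<bar>x\<bar>\<^sup>p\<close> because \<open>p \<ge> 1\<close>.\<close>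

lemma Lp_functions_set_integrable:
  assumes p: "1 \<le> p" and x: "x \<in> Lp_functions M p"
    and E: "E \<in> sets M" "emeasure M E < \<infinity>"
  shows "set_integrable M E x"
proof -
  have [measurable]: "x \<in> borel_measurable M" "E \<in> sets M"
    using x E by (auto simp: Lp_functions_def)
  have ind: "integrable M (\<lambda>t. indicator E t * C)" for C :: real
    using E by (intro integrable_mult_left) (simp add: integrable_indicator_iff)
  show ?thesis
  proof (cases "p = \<infinity>")
    case True
    then obtain C where C: "AE t in M. \<bar>x t\<bar> \<le> C"
      using x by (auto simp: Lp_functions_def)
    show ?thesis
      unfolding set_integrable_def
    proof (rule Bochner_Integration.integrable_bound[OF ind[of C]])
      show "AE t in M. norm (indicat_real E t *\<^sub>R x t) \<le> norm (indicator E t * C)"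
        using C by eventually_elim (auto simp: indicator_def)
    qed measurable
  next
    case False
    define q where "q = enn2real p"
    have q: "1 \<le> q"
      using p False enn2real_mono[of 1 p] by (simp add: q_def top.not_eq_extremum)
    have "integrable M (\<lambda>t. \<bar>x t\<bar> powr q)"
      using x False by (simp add: Lp_functions_def q_def)
    then have int: "integrable M (\<lambda>t. indicator E t * 1 + \<bar>x t\<bar> powr q)"
      using ind[of 1] by (intro Bochner_Integration.integrable_add)
    have le: "\<bar>y\<bar> \<le> 1 + \<bar>y\<bar> powr q" for y :: real
    proof (cases "\<bar>y\<bar> \<le> 1")
      case True
      then show ?thesis by (smt (verit) powr_ge_zero)
    next
      case False
      then have "\<bar>y\<bar> powr 1 \<le> \<bar>y\<bar> powr q"
        using q by (intro powr_mono) auto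
      then show ?thesis using False by simp
    qed
    show ?thesis
      unfolding set_integrable_def
    proof (rule Bochner_Integration.integrable_bound[OF int])
      show "AE t in M. norm (indicat_real E t *\<^sub>R x t)
          \<le> norm (indicator E t * 1 + \<bar>x t\<bar> powr q)"
        using le by (intro AE_I2) (auto simp: indicator_def)
    qed measurable
  qed
qed

section \<open>Operators with a kernel spanned by two orthogonal functions\<close>

text \<open>The functions \<open>u\<close> and \<open>v\<close> are orthogonal on \<open>J\<close>, while the images of the operators are cut off to
  the possibly larger set \<open>I\<close>.\<close>

locale orthogonal_pair =
  fixes M :: "'a measure" and I J :: "'a set" and u v :: "'a \<Rightarrow> real" and K :: real
  assumes I: "I \<in> sets M" "emeasure M I < \<infinity>"
    and J: "J \<in> sets M" "J \<subseteq> I"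
    and u_measurable [measurable]: "u \<in> borel_measurable M"
    and v_measurable [measurable]: "v \<in> borel_measurable M"
    and u_bound: "\<bar>u t\<bar> \<le> K" and v_bound: "\<bar>v t\<bar> \<le> K"
    and orthogonal: "(LINT s:J|M. u s * v s) = 0"
begin

definition moment :: "('a \<Rightarrow> real) \<Rightarrow> ('a \<Rightarrow> real) \<Rightarrow> real" where
  "moment f x = (LINT s:J|M. f s * x s)"

definition kernel_op :: "real \<Rightarrow> real \<Rightarrow> real \<Rightarrow> real \<Rightarrow> ('a \<Rightarrow> real) \<Rightarrow> 'a \<Rightarrow> real" where
  "kernel_op a b c d x = (\<lambda>t. LINT s:J|M. indicator I t *
     (a * u t * v s + b * v t * v s + c * u t * u s + d * v t * u s) * x s)"

definition cut_combination :: "real \<Rightarrow> real \<Rightarrow> 'a \<Rightarrow> real" where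
  "cut_combination k l t = indicator I t * (k * u t + l * v t)"

lemma J_finite: "emeasure M J < \<infinity>"
  using I J by (meson emeasure_mono order_le_less_trans)

lemma set_integrable_bounded_mult:
  fixes f x :: "'a \<Rightarrow> real"
  assumes [measurable]: "f \<in> borel_measurable M" and bound: "\<And>t. \<bar>f t\<bar> \<le> C"
    and x: "set_integrable M J x"
  shows "set_integrable M J (\<lambda>s. f s * x s)"
proof -
  let ?x = "\<lambda>s. indicat_real J s *\<^sub>R x s"
  have x': "integrable M ?x"
    using x by (simp add: set_integrable_def)
  have "integrable M (\<lambda>s. f s * ?x s)"
  proof (rule Bochner_Integration.integrable_bound)
    show "integrable M (\<lambda>s. C * ?x s)"
      using x' by (rule integrable_mult_right)
    show "(\<lambda>s. f s * ?x s) \<in> borel_measurable M"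
      using borel_measurable_integrable[OF x'] by measurable
    show "AE s in M. norm (f s * ?x s) \<le> norm (C * ?x s)"
    proof (rule AE_I2)
      fix s
      have "\<bar>f s\<bar> \<le> \<bar>C\<bar>" using bound[of s] by linarith
      then show "norm (f s * ?x s) \<le> norm (C * ?x s)"
        by (simp add: abs_mult mult_right_mono)
    qed
  qed
  then show ?thesis
    by (simp add: set_integrable_def mult_ac)
qed

lemmas integrable_moments =
  set_integrable_bounded_mult[OF u_measurable u_bound]
  set_integrable_bounded_mult[OF v_measurable v_bound]

lemma cut_combination_measurable [measurable]: "cut_combination k l \<in> borel_measurable M"
  unfolding cut_combination_def[abs_def] using I by measurable

lemma cut_combination_in_Lp: "cut_combination k l \<in> Lp_functions M p"
proof (rule bounded_finite_support_in_Lp[OF cut_combination_measurable I])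
  fix t
  have "\<bar>k * u t + l * v t\<bar> \<le> \<bar>k\<bar> * \<bar>u t\<bar> + \<bar>l\<bar> * \<bar>v t\<bar>"
    by (metis abs_mult abs_triangle_ineq)
  also have "\<dots> \<le> \<bar>k\<bar> * K + \<bar>l\<bar> * K"
    by (intro add_mono mult_left_mono u_bound v_bound) auto
  finally have *: "\<bar>k * u t + l * v t\<bar> \<le> \<bar>k\<bar> * K + \<bar>l\<bar> * K" .
  then have "0 \<le> \<bar>k\<bar> * K + \<bar>l\<bar> * K" by linarith
  with * show "\<bar>cut_combination k l t\<bar> \<le> \<bar>k\<bar> * K + \<bar>l\<bar> * K"
    by (simp add: cut_combination_def indicator_def)
qed (simp add: cut_combination_def)

lemma cut_combination_integrable: "set_integrable M J (cut_combination k l)"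
  using Lp_functions_set_integrable[of 1, OF _ cut_combination_in_Lp J(1) J_finite] by simp

text \<open>The Gram matrix of \<open>u\<close> and \<open>v\<close> on \<open>J\<close> is diagonal, and \<open>J \<subseteq> I\<close> hides the cut-off.\<close>

lemma moment_cut_combination:
  shows "moment u (cut_combination k l) = k * moment u u"
    and "moment v (cut_combination k l) = l * moment v v"
proof -
  have cut: "cut_combination k l s = k * u s + l * v s" if "s \<in> J" for k l s
    using that J by (auto simp: cut_combination_def)
  have int: "set_integrable M J (\<lambda>s. k * u s + l * v s)" for k l
  proof -
    have "set_integrable M J (\<lambda>s. k * u s + l * v s) = set_integrable M J (cut_combination k l)"
      by (rule set_integrable_cong) (simp_all add: cut)
    then show ?thesis using cut_combination_integrable by simp
  qed
  have ints: "set_integrable M J u" "set_integrable M J v"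
    using int[of 1 0] int[of 0 1] by simp_all
  note prods = integrable_moments[OF ints(1)] integrable_moments[OF ints(2)]
  have "moment f (cut_combination k l) = (LINT s:J|M. k * (f s * u s) + l * (f s * v s))" for f
    unfolding moment_def
    by (rule set_lebesgue_integral_cong) (auto simp: J(1) cut algebra_simps)
  note mom = this
  show "moment u (cut_combination k l) = k * moment u u"
    unfolding mom using prods orthogonal
    by (subst set_integral_add) (auto simp: moment_def)
  show "moment v (cut_combination k l) = l * moment v v"
    unfolding mom using prods orthogonal
    by (subst set_integral_add) (auto simp: moment_def mult.commute)
qed

lemma kernel_op_eq_cut_combination:
  assumes x: "set_integrable M J x"
  shows "kernel_op a b c d x =
    cut_combination (a * moment v x + c * moment u x) (b * moment v x + d * moment u x)"
proof
  fix t
  define i where "i = indicat_real I t"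
  have "kernel_op a b c d x t = (LINT s:J|M. i * (a * u t + b * v t) * (v s * x s)
      + i * (c * u t + d * v t) * (u s * x s))"
    unfolding kernel_op_def i_def by (simp add: algebra_simps)
  also have "\<dots> = i * (a * u t + b * v t) * moment v x + i * (c * u t + d * v t) * moment u x"
    using integrable_moments[OF x]
    by (subst set_integral_add) (auto simp: moment_def)
  also have "\<dots> = cut_combination (a * moment v x + c * moment u x)
      (b * moment v x + d * moment u x) t"
    by (simp add: cut_combination_def i_def algebra_simps)
  finally show "kernel_op a b c d x t = \<dots>" .
qed

text \<open>This is the matrix \<open>P G Q - Q G P\<close>, where \<open>P\<close> has rows \<open>(a3, a1)\<close> and \<open>(a4, a2)\<close>, \<open>Q\<close> likewise, and
  \<open>G\<close> is the diagonal Gram matrix. In its diagonal entries, the second and third coefficient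
  below, the products \<open>a2 * b2\<close> and \<open>a3 * b3\<close> cancel.\<close>

lemma kernel_op_commutator:
  assumes x: "set_integrable M J x"
  defines "\<sigma>u \<equiv> moment u u" and "\<sigma>v \<equiv> moment v v"
  shows "kernel_op a1 a2 a3 a4 (kernel_op b1 b2 b3 b4 x) t
      - kernel_op b1 b2 b3 b4 (kernel_op a1 a2 a3 a4 x) t =
    kernel_op (a3 * b1 * \<sigma>u - b3 * a1 * \<sigma>u + a1 * b2 * \<sigma>v - b1 * a2 * \<sigma>v)
      ((b1 * a4 - a1 * b4) * \<sigma>u) ((a1 * b4 - b1 * a4) * \<sigma>v)
      (a4 * b3 * \<sigma>u - b4 * a3 * \<sigma>u + a2 * b4 * \<sigma>v - b2 * a4 * \<sigma>v) x t"
  unfolding kernel_op_eq_cut_combination[OF x]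
    kernel_op_eq_cut_combination[OF cut_combination_integrable]
    moment_cut_combination \<sigma>u_def[symmetric] \<sigma>v_def[symmetric]
  by (simp add: cut_combination_def algebra_simps)

text \<open>A function that vanishes almost everywhere has zero moments; here the moments against \<open>u\<close> and
  \<open>v\<close> are \<open>k \<integral> u\<^sup>2\<close> and \<open>l \<integral> v\<^sup>2\<close> over \<open>J\<close>.\<close>

lemma cut_combination_AE_zeroD:
  assumes zero: "AE t in M. cut_combination k l t = 0"
    and nz: "moment u u \<noteq> 0" "moment v v \<noteq> 0"
  shows "k = 0" "l = 0"
proof -
  have "moment f (cut_combination k l) = 0" for f
  proof -
    have "AE s in M. indicat_real J s *\<^sub>R (f s * cut_combination k l s) = 0"
      using zero by eventually_elim simp
    then show ?thesis
      unfolding moment_def set_lebesgue_integral_def by (rule integral_eq_zero_AE)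
  qed
  then show "k = 0" "l = 0"
    using nz moment_cut_combination[of k l] by auto
qed

lemma kernel_op_zero_iff:
  assumes p: "1 \<le> p" and nz: "moment u u \<noteq> 0" "moment v v \<noteq> 0"
  shows "(\<forall>x \<in> Lp_functions M p. AE t in M. kernel_op a b c d x t = 0)
    \<longleftrightarrow> a = 0 \<and> b = 0 \<and> c = 0 \<and> d = 0" (is "?L \<longleftrightarrow> ?R")
proof
  assume L: ?L
  have image: "AE t in M. cut_combination (a * (l * moment v v) + c * (k * moment u u))
      (b * (l * moment v v) + d * (k * moment u u)) t = 0" for k l
    using L cut_combination_in_Lp[of k l p]
      kernel_op_eq_cut_combination[OF cut_combination_integrable, of a b c d k l]
    by (metis moment_cut_combination)
  \<comment> \<open>The test functions \<open>u\<close> and \<open>v\<close> pick out the two columns of the matrix.\<close>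
  show ?R
    using cut_combination_AE_zeroD[OF image[of 0 1] nz] cut_combination_AE_zeroD[OF image[of 1 0] nz] nz
    by simp
qed (auto simp: kernel_op_def)

lemma kernel_op_in_Lp:
  assumes "1 \<le> p" "x \<in> Lp_functions M p"
  shows "kernel_op a b c d x \<in> Lp_functions M p"
  using Lp_functions_set_integrable[OF assms J(1) J_finite]
  by (simp add: kernel_op_eq_cut_combination cut_combination_in_Lp)

lemma lifted_op_maps_Lp:
  assumes "1 \<le> p"
    and T: "\<forall>x \<in> Lp_functions M p. T (ae_class M x) = ae_class M (kernel_op a b c d x)"
  shows "T \<in> Lp_space M p \<rightarrow> Lp_space M p"
  using kernel_op_in_Lp[OF \<open>1 \<le> p\<close>] by (auto simp: Lp_space_def T)

context
  fixes p :: ennreal and S T :: "('a \<Rightarrow> real) set \<Rightarrow> ('a \<Rightarrow> real) set"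
    and a1 a2 a3 a4 b1 b2 b3 b4 c1 c2 c3 c4 :: real
  assumes p: "1 \<le> p"
    and S: "\<forall>x \<in> Lp_functions M p. S (ae_class M x) = ae_class M (kernel_op a1 a2 a3 a4 x)"
    and T: "\<forall>x \<in> Lp_functions M p. T (ae_class M x) = ae_class M (kernel_op b1 b2 b3 b4 x)"
  defines "c1 \<equiv> a3 * b1 * moment u u - b3 * a1 * moment u u
      + a1 * b2 * moment v v - b1 * a2 * moment v v"
    and "c2 \<equiv> (b1 * a4 - a1 * b4) * moment u u"
    and "c3 \<equiv> (a1 * b4 - b1 * a4) * moment v v"
    and "c4 \<equiv> a4 * b3 * moment u u - b4 * a3 * moment u u
      + a2 * b4 * moment v v - b2 * a4 * moment v v"
begin

lemma lifted_compositions: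
  assumes "x \<in> Lp_functions M p"
  shows "S (T (ae_class M x)) = ae_class M (kernel_op a1 a2 a3 a4 (kernel_op b1 b2 b3 b4 x))"
    and "T (S (ae_class M x)) = ae_class M (kernel_op b1 b2 b3 b4 (kernel_op a1 a2 a3 a4 x))"
  using assms kernel_op_in_Lp[OF p] by (simp_all add: S T)

lemma commutator_pointwise:
  assumes "x \<in> Lp_functions M p"
  shows "kernel_op a1 a2 a3 a4 (kernel_op b1 b2 b3 b4 x) t
      - kernel_op b1 b2 b3 b4 (kernel_op a1 a2 a3 a4 x) t = kernel_op c1 c2 c3 c4 x t"
  unfolding c1_def c2_def c3_def c4_def
  by (rule kernel_op_commutator[OF Lp_functions_set_integrable[OF p assms J(1) J_finite]])

lemma lifted_commutator:
  assumes X: "X \<in> Lp_space M p" "x \<in> X" and y: "y \<in> S (T X)" and z: "z \<in> T (S X)"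
  shows "AE t in M. y t - z t = kernel_op c1 c2 c3 c4 x t"
proof -
  note x = Lp_space_memberD[OF X]
  have "AE t in M. y t = kernel_op a1 a2 a3 a4 (kernel_op b1 b2 b3 b4 x) t"
    using y unfolding x(2) lifted_compositions[OF x(1)] by (simp add: ae_class_def)
  moreover have "AE t in M. z t = kernel_op b1 b2 b3 b4 (kernel_op a1 a2 a3 a4 x) t"
    using z unfolding x(2) lifted_compositions[OF x(1)] by (simp add: ae_class_def)
  ultimately show ?thesis
    by eventually_elim (simp add: commutator_pointwise[OF x(1)])
qed

lemma lifted_commute_iff:
  assumes nz: "moment u u \<noteq> 0" "moment v v \<noteq> 0"
  shows "(\<forall>X \<in> Lp_space M p. S (T X) = T (S X)) \<longleftrightarrow> c1 = 0 \<and> c2 = 0 \<and> c3 = 0 \<and> c4 = 0"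
proof -
  have "S (T (ae_class M x)) = T (S (ae_class M x))
      \<longleftrightarrow> (AE t in M. kernel_op c1 c2 c3 c4 x t = 0)" if x: "x \<in> Lp_functions M p" for x
  proof -
    have "kernel_op a1 a2 a3 a4 (kernel_op b1 b2 b3 b4 x) \<in> borel_measurable M"
      and "kernel_op b1 b2 b3 b4 (kernel_op a1 a2 a3 a4 x) \<in> borel_measurable M"
      using x by (auto intro!: Lp_functions_measurable[of _ M p] kernel_op_in_Lp[OF p])
    then show ?thesis
      by (simp add: lifted_compositions[OF x] ae_class_eq_iff commutator_pointwise[OF x, symmetric])
  qed
  then show ?thesis
    using kernel_op_zero_iff[OF p nz, of c1 c2 c3 c4] by (auto simp: Lp_space_def)
qed

end

end

section \<open>The trigonometric Gram matrix\<close>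

lemma set_lebesgue_integral_by_antiderivative:
  fixes F f :: "real \<Rightarrow> real"
  assumes "a \<le> b" and "continuous_on {a..b} f"
    and "\<And>s. (F has_real_derivative f s) (at s)"
  shows "(LINT s:{a..b}|lebesgue. f s) = F b - F a"
proof -
  have "(f has_integral F b - F a) {a..b}"
    using assms(1,3)
    by (intro fundamental_theorem_of_calculus)
      (auto simp: has_real_derivative_iff_has_vector_derivative[symmetric]
        intro: has_field_derivative_at_within)
  moreover have "set_integrable lebesgue {a..b} f"
    using assms(2) by (rule absolutely_integrable_continuous_real)
  ultimately show ?thesis
    by (simp add: set_lebesgue_integral_eq_integral(2) integral_unique)
qed

lemma sin_cos_diff: "sin b * cos b - sin a * cos a = cos (a + b) * sin (b - a)" for a b :: real
proof -
  have "cos (a + b) * sin (b - a)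
      = sin b * cos b * ((sin a)\<^sup>2 + (cos a)\<^sup>2) - sin a * cos a * ((sin b)\<^sup>2 + (cos b)\<^sup>2)"
    unfolding cos_add sin_diff by algebra
  then show ?thesis by simp
qed

lemma integral_sin_squared:
  fixes a b \<omega> :: real
  assumes "a \<le> b" "\<omega> \<noteq> 0"
  shows "(LINT s:{a..b}|lebesgue. (sin (\<omega> * s))\<^sup>2)
    = (b - a) / 2 - cos (\<omega> * (a + b)) * sin (\<omega> * (b - a)) / (2 * \<omega>)"
proof -
  let ?F = "\<lambda>s. s / 2 - sin (\<omega> * s) * cos (\<omega> * s) / (2 * \<omega>)"
  have "(?F has_real_derivative (sin (\<omega> * s))\<^sup>2) (at s)" for s
  proof -
    have "(?F has_real_derivative (1 - ((cos (\<omega> * s))\<^sup>2 - (sin (\<omega> * s))\<^sup>2)) / 2) (at s)"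
      using assms(2)
      by (auto intro!: derivative_eq_intros simp: field_simps power2_eq_square)
    then show ?thesis by (simp add: cos_squared_eq)
  qed
  then have "(LINT s:{a..b}|lebesgue. (sin (\<omega> * s))\<^sup>2) = ?F b - ?F a"
    using assms(1)
    by (intro set_lebesgue_integral_by_antiderivative) (auto intro!: continuous_intros)
  also have "\<dots> = (b - a) / 2
      - (sin (\<omega> * b) * cos (\<omega> * b) - sin (\<omega> * a) * cos (\<omega> * a)) / (2 * \<omega>)"
    by (simp add: diff_divide_distrib)
  finally show ?thesis
    by (simp only: sin_cos_diff distrib_left right_diff_distrib)
qed

lemma integral_cos_squared:
  fixes a b \<omega> :: real
  assumes "a \<le> b"
  shows "(LINT s:{a..b}|lebesgue. (cos (\<omega> * s))\<^sup>2)
    = b - a - (LINT s:{a..b}|lebesgue. (sin (\<omega> * s))\<^sup>2)"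
proof -
  have "(LINT s:{a..b}|lebesgue. (cos (\<omega> * s))\<^sup>2) = (LINT s:{a..b}|lebesgue. 1 - (sin (\<omega> * s))\<^sup>2)"
    by (simp add: cos_squared_eq)
  also have "\<dots> = (LINT s:{a..b}|lebesgue. 1) - (LINT s:{a..b}|lebesgue. (sin (\<omega> * s))\<^sup>2)"
    by (intro set_integral_diff(2) absolutely_integrable_continuous_real continuous_intros)
  also have "(LINT s:{a..b}|lebesgue. 1) = b - a"
    using set_lebesgue_integral_by_antiderivative[OF assms, of "\<lambda>_. 1" "\<lambda>s. s"] by simp
  finally show ?thesis .
qed

lemma sin_eq_0_of_integer_multiple:
  fixes \<omega> r :: real
  assumes "\<omega> / pi * r \<in> \<int>"
  shows "sin (\<omega> * r) = 0"
proof -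
  obtain n :: int where "\<omega> / pi * r = of_int n"
    using assms by (auto elim: Ints_cases)
  then have "\<omega> * r = of_int n * pi"
    by (simp add: field_simps)
  then show ?thesis by (simp add: sin_zero_iff_int2)
qed

lemma integral_sin_cos_eq_0:
  fixes a b \<omega> :: real
  assumes "a \<le> b" and "\<omega> / pi * (b - a) \<in> \<int> \<or> \<omega> / pi * (b + a) \<in> \<int>"
  shows "(LINT s:{a..b}|lebesgue. sin (\<omega> * s) * cos (\<omega> * s)) = 0"
proof (cases "\<omega> = 0")
  case False
  have sq: "(sin (\<omega> * b))\<^sup>2 - (sin (\<omega> * a))\<^sup>2 = sin (\<omega> * (b - a)) * sin (\<omega> * (b + a))"
  proof -
    have "sin (\<omega> * (b - a)) * sin (\<omega> * (b + a))
        = (sin (\<omega> * b))\<^sup>2 * (cos (\<omega> * a))\<^sup>2 - (cos (\<omega> * b))\<^sup>2 * (sin (\<omega> * a))\<^sup>2"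
      unfolding right_diff_distrib distrib_left sin_diff sin_add
      by (simp add: algebra_simps power2_eq_square)
    then show ?thesis
      by (simp add: cos_squared_eq algebra_simps)
  qed
  let ?F = "\<lambda>s. (sin (\<omega> * s))\<^sup>2 / (2 * \<omega>)"
  have "(?F has_real_derivative sin (\<omega> * s) * cos (\<omega> * s)) (at s)" for s
    using False by (auto intro!: derivative_eq_intros simp: field_simps)
  then have "(LINT s:{a..b}|lebesgue. sin (\<omega> * s) * cos (\<omega> * s)) = ?F b - ?F a"
    using assms(1)
    by (intro set_lebesgue_integral_by_antiderivative) (auto intro!: continuous_intros)
  also have "\<dots> = sin (\<omega> * (b - a)) * sin (\<omega> * (b + a)) / (2 * \<omega>)"
    by (simp add: sq[symmetric] diff_divide_distrib)
  also have "\<dots> = 0"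
    using assms(2) by (metis sin_eq_0_of_integer_multiple mult_eq_0_iff div_0)
  finally show ?thesis .
qed simp

section \<open>Commuting trigonometric integral operators on Lp\<close>

theorem proposition2:
  fixes p :: ennreal
    and \<theta>A \<theta>B :: "nat \<Rightarrow> real"
    and \<omega> \<alpha> \<beta> \<alpha>\<^sub>1 \<beta>\<^sub>1 \<sigma>\<^sub>1 \<sigma>\<^sub>2 :: real
    and A B :: "(real \<Rightarrow> real) set \<Rightarrow> (real \<Rightarrow> real) set"
  assumes p: "1 \<le> p"
    and bounds: "\<alpha>\<^sub>1 < \<beta>\<^sub>1" "\<alpha> \<le> \<alpha>\<^sub>1" "\<beta> \<ge> \<beta>\<^sub>1"
    and period: "\<omega> / pi * (\<beta>\<^sub>1 - \<alpha>\<^sub>1) \<in> \<int> \<or> \<omega> / pi * (\<beta>\<^sub>1 + \<alpha>\<^sub>1) \<in> \<int>"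
    and A: "\<And>x. x \<in> Lp_functions lebesgue p \<Longrightarrow>
      A (ae_class lebesgue x) = ae_class lebesgue
        (\<lambda>t. LINT s:{\<alpha>\<^sub>1..\<beta>\<^sub>1}|lebesgue. indicator {\<alpha>..\<beta>} t *
          (\<theta>A 1 * sin (\<omega> * t) * cos (\<omega> * s) + \<theta>A 2 * cos (\<omega> * t) * cos (\<omega> * s)
           + \<theta>A 3 * sin (\<omega> * t) * sin (\<omega> * s) + \<theta>A 4 * cos (\<omega> * t) * sin (\<omega> * s)) * x s)"
    and B: "\<And>x. x \<in> Lp_functions lebesgue p \<Longrightarrow>
      B (ae_class lebesgue x) = ae_class lebesgue
        (\<lambda>t. LINT s:{\<alpha>\<^sub>1..\<beta>\<^sub>1}|lebesgue. indicator {\<alpha>..\<beta>} t *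
          (\<theta>B 1 * sin (\<omega> * t) * cos (\<omega> * s) + \<theta>B 2 * cos (\<omega> * t) * cos (\<omega> * s)
           + \<theta>B 3 * sin (\<omega> * t) * sin (\<omega> * s) + \<theta>B 4 * cos (\<omega> * t) * sin (\<omega> * s)) * x s)"
    and \<sigma>\<^sub>1: "\<sigma>\<^sub>1 = (LINT s:{\<alpha>\<^sub>1..\<beta>\<^sub>1}|lebesgue. (sin (\<omega> * s))\<^sup>2)"
    and \<sigma>\<^sub>2: "\<sigma>\<^sub>2 = (LINT s:{\<alpha>\<^sub>1..\<beta>\<^sub>1}|lebesgue. (cos (\<omega> * s))\<^sup>2)"
  shows "(A \<in> Lp_space lebesgue p \<rightarrow> Lp_space lebesgue p)
    \<and> (B \<in> Lp_space lebesgue p \<rightarrow> Lp_space lebesgue p)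
    \<and> (\<sigma>\<^sub>1 = (if \<omega> = 0 then 0
      else (\<beta>\<^sub>1 - \<alpha>\<^sub>1) / 2 - cos (\<omega> * (\<alpha>\<^sub>1 + \<beta>\<^sub>1)) * sin (\<omega> * (\<beta>\<^sub>1 - \<alpha>\<^sub>1)) / (2 * \<omega>)))
    \<and> (\<sigma>\<^sub>2 = \<beta>\<^sub>1 - \<alpha>\<^sub>1 - \<sigma>\<^sub>1)
    \<and> (\<sigma>\<^sub>2 = (if \<omega> = 0 then \<beta>\<^sub>1 - \<alpha>\<^sub>1
      else (\<beta>\<^sub>1 - \<alpha>\<^sub>1) / 2 + cos (\<omega> * (\<alpha>\<^sub>1 + \<beta>\<^sub>1)) * sin (\<omega> * (\<beta>\<^sub>1 - \<alpha>\<^sub>1)) / (2 * \<omega>)))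
    \<and> (\<forall>X \<in> Lp_space lebesgue p. \<forall>x \<in> X. \<forall>y \<in> A (B X). \<forall>z \<in> B (A X). AE t in lebesgue.
      y t - z t = (LINT s:{\<alpha>\<^sub>1..\<beta>\<^sub>1}|lebesgue. indicator {\<alpha>..\<beta>} t *
        ((\<theta>A 3 * \<theta>B 1 * \<sigma>\<^sub>1 - \<theta>B 3 * \<theta>A 1 * \<sigma>\<^sub>1 + \<theta>A 1 * \<theta>B 2 * \<sigma>\<^sub>2 - \<theta>B 1 * \<theta>A 2 * \<sigma>\<^sub>2)
             * sin (\<omega> * t) * cos (\<omega> * s)
         + (\<theta>B 1 * \<theta>A 4 - \<theta>A 1 * \<theta>B 4) * \<sigma>\<^sub>1 * cos (\<omega> * t) * cos (\<omega> * s)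
         + (\<theta>A 1 * \<theta>B 4 - \<theta>B 1 * \<theta>A 4) * \<sigma>\<^sub>2 * sin (\<omega> * t) * sin (\<omega> * s)
         + (\<theta>A 4 * \<theta>B 3 * \<sigma>\<^sub>1 - \<theta>B 4 * \<theta>A 3 * \<sigma>\<^sub>1 + \<theta>A 2 * \<theta>B 4 * \<sigma>\<^sub>2 - \<theta>B 2 * \<theta>A 4 * \<sigma>\<^sub>2)
             * cos (\<omega> * t) * sin (\<omega> * s)) * x s))
    \<and> (\<sigma>\<^sub>1 \<noteq> 0 \<and> \<sigma>\<^sub>2 \<noteq> 0 \<longrightarrow>
      ((\<forall>X \<in> Lp_space lebesgue p. A (B X) = B (A X)) \<longleftrightarrow>
        \<theta>A 3 * \<theta>B 1 * \<sigma>\<^sub>1 - \<theta>B 3 * \<theta>A 1 * \<sigma>\<^sub>1 = \<theta>B 1 * \<theta>A 2 * \<sigma>\<^sub>2 - \<theta>A 1 * \<theta>B 2 * \<sigma>\<^sub>2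
        \<and> \<theta>A 4 * \<theta>B 1 = \<theta>B 4 * \<theta>A 1
        \<and> \<theta>A 4 * \<theta>B 3 * \<sigma>\<^sub>1 - \<theta>B 4 * \<theta>A 3 * \<sigma>\<^sub>1 = \<theta>B 2 * \<theta>A 4 * \<sigma>\<^sub>2 - \<theta>A 2 * \<theta>B 4 * \<sigma>\<^sub>2))"
proof -
  have le: "\<alpha>\<^sub>1 \<le> \<beta>\<^sub>1" using bounds by simp
  interpret orthogonal_pair lebesgue "{\<alpha>..\<beta>}" "{\<alpha>\<^sub>1..\<beta>\<^sub>1}"
    "\<lambda>t. sin (\<omega> * t)" "\<lambda>t. cos (\<omega> * t)" 1
  proof
    show "(\<lambda>t. sin (\<omega> * t)) \<in> borel_measurable lebesgue"
      "(\<lambda>t. cos (\<omega> * t)) \<in> borel_measurable lebesgue"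
      by (intro measurable_completion; simp)+
    show "(LINT s:{\<alpha>\<^sub>1..\<beta>\<^sub>1}|lebesgue. sin (\<omega> * s) * cos (\<omega> * s)) = 0"
      using le period by (rule integral_sin_cos_eq_0)
  qed (use bounds in \<open>auto simp: emeasure_lborel_Icc_eq\<close>)
  have gram: "moment (\<lambda>t. sin (\<omega> * t)) (\<lambda>t. sin (\<omega> * t)) = \<sigma>\<^sub>1"
    "moment (\<lambda>t. cos (\<omega> * t)) (\<lambda>t. cos (\<omega> * t)) = \<sigma>\<^sub>2"
    by (simp_all add: moment_def \<sigma>\<^sub>1 \<sigma>\<^sub>2 power2_eq_square)
  have A_kernel: "\<forall>x \<in> Lp_functions lebesgue p. A (ae_class lebesgue x) =
      ae_class lebesgue (kernel_op (\<theta>A 1) (\<theta>A 2) (\<theta>A 3) (\<theta>A 4) x)"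
    unfolding kernel_op_def using A by blast
  have B_kernel: "\<forall>x \<in> Lp_functions lebesgue p. B (ae_class lebesgue x) =
      ae_class lebesgue (kernel_op (\<theta>B 1) (\<theta>B 2) (\<theta>B 3) (\<theta>B 4) x)"
    unfolding kernel_op_def using B by blast
  note lift = p A_kernel B_kernel
  have \<sigma>\<^sub>1_eq: "\<sigma>\<^sub>1 = (if \<omega> = 0 then 0
      else (\<beta>\<^sub>1 - \<alpha>\<^sub>1) / 2 - cos (\<omega> * (\<alpha>\<^sub>1 + \<beta>\<^sub>1)) * sin (\<omega> * (\<beta>\<^sub>1 - \<alpha>\<^sub>1)) / (2 * \<omega>))"
    unfolding \<sigma>\<^sub>1 using integral_sin_squared[OF le] by simp
  have \<sigma>\<^sub>2_eq: "\<sigma>\<^sub>2 = \<beta>\<^sub>1 - \<alpha>\<^sub>1 - \<sigma>\<^sub>1"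
    unfolding \<sigma>\<^sub>1 \<sigma>\<^sub>2 by (rule integral_cos_squared[OF le])
  show ?thesis
  proof (intro conjI)
    show "A \<in> Lp_space lebesgue p \<rightarrow> Lp_space lebesgue p"
      using p A_kernel by (rule lifted_op_maps_Lp)
    show "B \<in> Lp_space lebesgue p \<rightarrow> Lp_space lebesgue p"
      using p B_kernel by (rule lifted_op_maps_Lp)
    show "\<sigma>\<^sub>2 = (if \<omega> = 0 then \<beta>\<^sub>1 - \<alpha>\<^sub>1
      else (\<beta>\<^sub>1 - \<alpha>\<^sub>1) / 2 + cos (\<omega> * (\<alpha>\<^sub>1 + \<beta>\<^sub>1)) * sin (\<omega> * (\<beta>\<^sub>1 - \<alpha>\<^sub>1)) / (2 * \<omega>))"
      unfolding \<sigma>\<^sub>2_eq \<sigma>\<^sub>1_eq by (cases "\<omega> = 0") simp_all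
  next
    show "\<forall>X \<in> Lp_space lebesgue p. \<forall>x \<in> X. \<forall>y \<in> A (B X). \<forall>z \<in> B (A X). AE t in lebesgue.
      y t - z t = (LINT s:{\<alpha>\<^sub>1..\<beta>\<^sub>1}|lebesgue. indicator {\<alpha>..\<beta>} t *
        ((\<theta>A 3 * \<theta>B 1 * \<sigma>\<^sub>1 - \<theta>B 3 * \<theta>A 1 * \<sigma>\<^sub>1 + \<theta>A 1 * \<theta>B 2 * \<sigma>\<^sub>2 - \<theta>B 1 * \<theta>A 2 * \<sigma>\<^sub>2)
             * sin (\<omega> * t) * cos (\<omega> * s)
         + (\<theta>B 1 * \<theta>A 4 - \<theta>A 1 * \<theta>B 4) * \<sigma>\<^sub>1 * cos (\<omega> * t) * cos (\<omega> * s)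
         + (\<theta>A 1 * \<theta>B 4 - \<theta>B 1 * \<theta>A 4) * \<sigma>\<^sub>2 * sin (\<omega> * t) * sin (\<omega> * s)
         + (\<theta>A 4 * \<theta>B 3 * \<sigma>\<^sub>1 - \<theta>B 4 * \<theta>A 3 * \<sigma>\<^sub>1 + \<theta>A 2 * \<theta>B 4 * \<sigma>\<^sub>2 - \<theta>B 2 * \<theta>A 4 * \<sigma>\<^sub>2)
             * cos (\<omega> * t) * sin (\<omega> * s)) * x s)"
    proof (intro ballI)
      fix X x y z
      assume "X \<in> Lp_space lebesgue p" "x \<in> X" "y \<in> A (B X)" "z \<in> B (A X)"
      from lifted_commutator[OF lift this, unfolded gram kernel_op_def]
      show "AE t in lebesgue.
      y t - z t = (LINT s:{\<alpha>\<^sub>1..\<beta>\<^sub>1}|lebesgue. indicator {\<alpha>..\<beta>} t *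
        ((\<theta>A 3 * \<theta>B 1 * \<sigma>\<^sub>1 - \<theta>B 3 * \<theta>A 1 * \<sigma>\<^sub>1 + \<theta>A 1 * \<theta>B 2 * \<sigma>\<^sub>2 - \<theta>B 1 * \<theta>A 2 * \<sigma>\<^sub>2)
             * sin (\<omega> * t) * cos (\<omega> * s)
         + (\<theta>B 1 * \<theta>A 4 - \<theta>A 1 * \<theta>B 4) * \<sigma>\<^sub>1 * cos (\<omega> * t) * cos (\<omega> * s)
         + (\<theta>A 1 * \<theta>B 4 - \<theta>B 1 * \<theta>A 4) * \<sigma>\<^sub>2 * sin (\<omega> * t) * sin (\<omega> * s)
         + (\<theta>A 4 * \<theta>B 3 * \<sigma>\<^sub>1 - \<theta>B 4 * \<theta>A 3 * \<sigma>\<^sub>1 + \<theta>A 2 * \<theta>B 4 * \<sigma>\<^sub>2 - \<theta>B 2 * \<theta>A 4 * \<sigma>\<^sub>2)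
             * cos (\<omega> * t) * sin (\<omega> * s)) * x s)" .
    qed
  next
    show "\<sigma>\<^sub>1 \<noteq> 0 \<and> \<sigma>\<^sub>2 \<noteq> 0 \<longrightarrow>
      ((\<forall>X \<in> Lp_space lebesgue p. A (B X) = B (A X)) \<longleftrightarrow>
        \<theta>A 3 * \<theta>B 1 * \<sigma>\<^sub>1 - \<theta>B 3 * \<theta>A 1 * \<sigma>\<^sub>1 = \<theta>B 1 * \<theta>A 2 * \<sigma>\<^sub>2 - \<theta>A 1 * \<theta>B 2 * \<sigma>\<^sub>2
        \<and> \<theta>A 4 * \<theta>B 1 = \<theta>B 4 * \<theta>A 1
        \<and> \<theta>A 4 * \<theta>B 3 * \<sigma>\<^sub>1 - \<theta>B 4 * \<theta>A 3 * \<sigma>\<^sub>1 = \<theta>B 2 * \<theta>A 4 * \<sigma>\<^sub>2 - \<theta>A 2 * \<theta>B 4 * \<sigma>\<^sub>2)"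
    proof
      assume nz: "\<sigma>\<^sub>1 \<noteq> 0 \<and> \<sigma>\<^sub>2 \<noteq> 0"
      note commute = lifted_commute_iff[OF lift, unfolded gram, OF conjunct1[OF nz] conjunct2[OF nz]]
      show "(\<forall>X \<in> Lp_space lebesgue p. A (B X) = B (A X)) \<longleftrightarrow>
        \<theta>A 3 * \<theta>B 1 * \<sigma>\<^sub>1 - \<theta>B 3 * \<theta>A 1 * \<sigma>\<^sub>1 = \<theta>B 1 * \<theta>A 2 * \<sigma>\<^sub>2 - \<theta>A 1 * \<theta>B 2 * \<sigma>\<^sub>2
        \<and> \<theta>A 4 * \<theta>B 1 = \<theta>B 4 * \<theta>A 1
        \<and> \<theta>A 4 * \<theta>B 3 * \<sigma>\<^sub>1 - \<theta>B 4 * \<theta>A 3 * \<sigma>\<^sub>1 = \<theta>B 2 * \<theta>A 4 * \<sigma>\<^sub>2 - \<theta>A 2 * \<theta>B 4 * \<sigma>\<^sub>2"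
        unfolding commute using nz by (auto simp: algebra_simps)
    qed
  qed (fact \<sigma>\<^sub>1_eq \<sigma>\<^sub>2_eq)+
qed

end
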